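(* Let $\mathcal Q$ be a logic on a Hilbert space $\mathcal H$ and let $\mathbf R_{\mathcal Q}\in V^{(\mathcal Q)}$ be the function with domain $\mathbf R^{(\mathcal Q)}$ taking the constant value $1$. Then: (i) $[\![(\forall u\in\mathbf R_{\mathcal Q})\,u=u]\!]=1$; (ii) $[\![(\forall u,v\in\mathbf R_{\mathcal Q})\,u=v\Rightarrow v=u]\!]=1$; (iii) $[\![(\forall u,v,w\in\mathbf R_{\mathcal Q})\,u=v\wedge v=w\Rightarrow u=w]\!]=1$; (iv) $[\![(\forall v\in\mathbf R_{\mathcal Q})(\forall x,y\in v)\,x=y\wedge x\in v\Rightarrow y\in v]\!]=1$; (v) $[\![(\forall u,v\in\mathbf R_{\mathcal Q})(\forall x\in u)\,x\in u\wedge u=v\Rightarrow x\in v]\!]=1$.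
   Context: $\mathcal Q(\mathcal H)$ is the lattice of orthogonal projections on $\mathcal H$ (order by inclusion of ranges, $\wedge,\vee$ = projections onto intersection / closed span of union of ranges, $P^\perp=1-P$); $\mathcal A^!$ is the set of projections commuting with all elements of $\mathcal A$; a logic is $\mathcal Q\subseteq\mathcal Q(\mathcal H)$ with $\mathcal Q=\mathcal Q^{!!}$. $P\Rightarrow Q=P^\perp\vee(P\wedge Q)$, $P\Leftrightarrow Q=(P\Rightarrow Q)\wedge(Q\Rightarrow P)$. $V^{(\mathcal Q)}=\bigcup_\alpha V^{(\mathcal Q)}_\alpha$, where $V^{(\mathcal Q)}_\alpha$ is the set of functions $u$ with values in $\mathcal Q$ and $\mathrm{dom}(u)\subseteq\bigcup_{\beta<\alpha}V^{(\mathcal Q)}_\beta$. Truth values are defined recursively: $[\![u=v]\!]=\bigwedge_{u'\in\mathrm{dom}(u)}(u(u')\Rightarrow[\![u'\in v]\!])\wedge\bigwedge_{v'\in\mathrm{dom}(v)}(v(v')\Rightarrow[\![v'\in u]\!])$, $[\![u\in v]\!]=\bigvee_{v'\in\mathrm{dom}(v)}(v(v')\wedge[\![u=v']\!])$, $[\![\neg\phi]\!]=[\![\phi]\!]^\perp$, connectives $\wedge,\vee,\Rightarrow,\Leftrightarrow$ by the lattice operations, $[\![(\forall x\in u)\phi]\!]=\bigwedge_{u'\in\mathrm{dom}(u)}(u(u')\Rightarrow[\![\phi(u')]\!])$, $[\![(\exists x\in u)\phi]\!]=\bigvee_{u'\in\mathrm{dom}(u)}(u(u')\wedge[\![\phi(u')]\!])$.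 For a set $v$, $\check v=\{(\check w,1):w\in v\}$; $\mathbf Q$ is the set of rationals. $\mathbf R(x)$ is the formula $x\subseteq\check{\mathbf Q}\wedge\exists y\in\check{\mathbf Q}(y\in x)\wedge\exists y\in\check{\mathbf Q}(y\notin x)\wedge\forall y\in\check{\mathbf Q}(y\in x\Leftrightarrow\forall z\in\check{\mathbf Q}(y<z\Rightarrow z\in x))$ ($x\subseteq y$ abbreviates $\forall z\in x(z\in y)$, $<$ the order of rationals, with $[\![\check r<\check s]\!]=1$ if $r<s$ and $0$ otherwise), and $\mathbf R^{(\mathcal Q)}=\{u\in V^{(\mathcal Q)}:\mathrm{dom}(u)=\{\check r:r\in\mathbf Q\},\ [\![\mathbf R(u)]\!]=1\}$. *)

theory Defs
  imports "HOL-Analysis.Analysis" "HOL-Library.Equipollence" "HOL-Library.Multiset"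
begin

unbundle lattice_syntax

section \<open>Complex Hilbert spaces and the lattice of projections\<close>

class complex_hilbert_space = banach +
  fixes scaleC :: "complex \<Rightarrow> 'a \<Rightarrow> 'a" (infixr "*\<^sub>C" 75)
    and cinner :: "'a \<Rightarrow> 'a \<Rightarrow> complex"
  assumes scaleC_add_right: "c *\<^sub>C (x + y) = c *\<^sub>C x + c *\<^sub>C y"
    and scaleC_add_left: "(c + d) *\<^sub>C x = c *\<^sub>C x + d *\<^sub>C x"
    and scaleC_scaleC: "c *\<^sub>C d *\<^sub>C x = (c * d) *\<^sub>C x"
    and scaleC_of_real: "complex_of_real r *\<^sub>C x = r *\<^sub>R x"
    and cinner_commute: "cinner x y = cnj (cinner y x)"
    and cinner_add_left: "cinner (x + y) z = cinner x z + cinner y z"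
    and cinner_scaleC_left: "cinner (c *\<^sub>C x) y = c * cinner x y"
    and cinner_self: "cinner x x = complex_of_real ((norm x)\<^sup>2)"

global_interpretation complex_vector: vector_space "scaleC :: complex \<Rightarrow> 'a \<Rightarrow> 'a :: complex_hilbert_space"
  defines cspan = complex_vector.span
proof
  show "1 *\<^sub>C x = x" for x :: 'a
    using scaleC_of_real[of 1 x] by simp
qed (simp_all add: scaleC_add_right scaleC_add_left scaleC_scaleC)

definition is_projection :: "('h::complex_hilbert_space \<Rightarrow> 'h) \<Rightarrow> bool" where
  "is_projection P \<longleftrightarrow> bounded_linear P \<and> (\<forall>c x. P (c *\<^sub>C x) = c *\<^sub>C P x) \<and>
     P \<circ> P = P \<and> (\<forall>x y. cinner (P x) y = cinner x (P y))"

typedef (overloaded) 'h proj = "{P :: 'h::complex_hilbert_space \<Rightarrow> 'h. is_projection P}"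
  morphisms app_proj Abs_proj
proof
  show "(\<lambda>x. x) \<in> {P :: 'h \<Rightarrow> 'h. is_projection P}"
    by (simp add: is_projection_def bounded_linear_ident comp_def)
qed

definition range_proj :: "'h::complex_hilbert_space proj \<Rightarrow> 'h set" where
  "range_proj P = range (app_proj P)"

definition proj_onto :: "'h::complex_hilbert_space set \<Rightarrow> 'h proj" where
  "proj_onto S = (THE P. range_proj P = S)"

text \<open>Only the symbols of the library's lattice classes are instantiated here; a meet is the
  projection onto the intersection of the ranges, a join the projection onto the closed linear span
  of their union, and \<^term>\<open>- P\<close> is the orthocomplement \<open>1 - P\<close>.
  \<open>\<top>\<close> is the identity, written 1 in the literature.\<close>

instantiation proj :: (complex_hilbert_space) "{ord, inf, sup, Inf, Sup, top, bot, uminus}"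
begin

definition less_eq_proj :: "'a proj \<Rightarrow> 'a proj \<Rightarrow> bool" where
  "P \<le> Q \<longleftrightarrow> range_proj P \<subseteq> range_proj Q"
definition less_proj :: "'a proj \<Rightarrow> 'a proj \<Rightarrow> bool" where
  "P < Q \<longleftrightarrow> range_proj P \<subset> range_proj Q"
definition inf_proj :: "'a proj \<Rightarrow> 'a proj \<Rightarrow> 'a proj" where
  "P \<sqinter> Q = proj_onto (range_proj P \<inter> range_proj Q)"
definition sup_proj :: "'a proj \<Rightarrow> 'a proj \<Rightarrow> 'a proj" where
  "P \<squnion> Q = proj_onto (closure (cspan (range_proj P \<union> range_proj Q)))"
definition Inf_proj :: "'a proj set \<Rightarrow> 'a proj" where
  "\<Sqinter> A = proj_onto (\<Inter>P\<in>A. range_proj P)"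
definition Sup_proj :: "'a proj set \<Rightarrow> 'a proj" where
  "\<Squnion> A = proj_onto (closure (cspan (\<Union>P\<in>A. range_proj P)))"
definition top_proj :: "'a proj" where
  "\<top> = Abs_proj (\<lambda>x. x)"
definition bot_proj :: "'a proj" where
  "\<bottom> = Abs_proj (\<lambda>x. 0)"
definition uminus_proj :: "'a proj \<Rightarrow> 'a proj" where
  "- P = Abs_proj (\<lambda>x. x - app_proj P x)"

instance ..

end

definition commutant :: "'h::complex_hilbert_space proj set \<Rightarrow> 'h proj set" where
  "commutant A = {P. \<forall>Q\<in>A. app_proj P \<circ> app_proj Q = app_proj Q \<circ> app_proj P}"

definition is_logic :: "'h::complex_hilbert_space proj set \<Rightarrow> bool" where
  "is_logic \<Q> \<longleftrightarrow> commutant (commutant \<Q>) = \<Q>"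

definition imp :: "'h::complex_hilbert_space proj \<Rightarrow> 'h proj \<Rightarrow> 'h proj" (infixr "\<rightarrow>\<^sub>Q" 60) where
  "P \<rightarrow>\<^sub>Q Q = - P \<squnion> (P \<sqinter> Q)"

definition iff :: "'h::complex_hilbert_space proj \<Rightarrow> 'h proj \<Rightarrow> 'h proj" (infix "\<leftrightarrow>\<^sub>Q" 60) where
  "P \<leftrightarrow>\<^sub>Q Q = (P \<rightarrow>\<^sub>Q Q) \<sqinter> (Q \<rightarrow>\<^sub>Q P)"


section \<open>Hereditary functions\<close>

text \<open>
  The universe \<open>V\<^sup>(\<^sup>Q\<^sup>)\<close> is a proper class. Here it is rendered by a type
  \<open>('k, 'q) hfun\<close> of well-founded hereditary functions with values in \<open>'q\<close> whose domains,
  hereditarily, have at most as many elements as the index type \<open>'k\<close>. Below,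
  \<open>fn\<close> maps \<open>hfun\<close> bijectively onto the partial functions
  \<open>('k, 'q) hfun \<rightharpoonup> 'q\<close> with such a domain; its inverse is \<open>Fn\<close>, and \<open>x \<in> dom (fn u)\<close> is a
  well-founded relation.

  For the construction, an element is a tree whose subtrees are indexed by \<open>'k\<close>; among all
  the enumerations of one and the same graph a canonical one is chosen.
\<close>

datatype ('k, 'q) tree = Node "'k \<Rightarrow> (('k, 'q) tree \<times> 'q) option"

definition node :: "(('k, 'q) tree \<rightharpoonup> 'q) \<Rightarrow> ('k, 'q) tree" where
  "node m = Node (SOME f. ran f = Map.graph m)"

inductive_set canonical :: "('k, 'q) tree set" where
  "\<lbrakk>\<forall>t\<in>dom m. t \<in> canonical; dom m \<lesssim> (UNIV :: 'k set)\<rbrakk> \<Longrightarrow> node m \<in> (canonical :: ('k, 'q) tree set)"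

typedef ('k, 'q) hfun = "canonical :: ('k, 'q) tree set"
  morphisms Rep_hfun Abs_hfun
  by (rule exI, rule canonical.intros[of Map.empty]) simp_all

definition Fn :: "(('k, 'q) hfun \<rightharpoonup> 'q) \<Rightarrow> ('k, 'q) hfun" where
  "Fn m = Abs_hfun (node (\<lambda>t. if t \<in> canonical then m (Abs_hfun t) else None))"

definition fn :: "('k, 'q) hfun \<Rightarrow> (('k, 'q) hfun \<rightharpoonup> 'q)" where
  "fn u = (THE m. dom m \<lesssim> (UNIV :: 'k set) \<and> u = Fn m)"

lemma node_inject:
  fixes m m' :: "('k, 'q) tree \<rightharpoonup> 'q"
  assumes "dom m \<lesssim> (UNIV :: 'k set)" "dom m' \<lesssim> (UNIV :: 'k set)" "node m = node m'"
  shows "m = m'"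
proof -
  have enum: "ran (SOME f :: 'k \<Rightarrow> _. ran f = Map.graph n) = Map.graph n"
    if "dom n \<lesssim> (UNIV :: 'k set)" for n :: "('k, 'q) tree \<rightharpoonup> 'q"
  proof -
    obtain g :: "('k, 'q) tree \<Rightarrow> 'k" where g: "inj_on g (dom n)"
      using \<open>dom n \<lesssim> UNIV\<close> by (auto simp: lepoll_def)
    define f where "f = (\<lambda>k. if k \<in> g ` dom n
      then Some (the_inv_into (dom n) g k, the (n (the_inv_into (dom n) g k))) else None)"
    have f: "f (g t) = Some (t, the (n t))" if "t \<in> dom n" for t
      using that g by (simp add: f_def the_inv_into_f_f)
    have "ran f = (\<lambda>t. (t, the (n t))) ` dom n"
    proof (intro equalityI subsetI)
      fix p assume "p \<in> ran f"
      then obtain k where k: "f k = Some p" by (auto simp: ran_def)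
      then have "k \<in> g ` dom n" by (metis f_def option.distinct(1))
      then obtain t where t: "t \<in> dom n" "k = g t" by blast
      then have "p = (t, the (n t))" using k f[OF t(1)] by simp
      then show "p \<in> (\<lambda>t. (t, the (n t))) ` dom n" using t(1) by (rule image_eqI)
    next
      fix p assume "p \<in> (\<lambda>t. (t, the (n t))) ` dom n"
      then obtain t where "t \<in> dom n" "p = (t, the (n t))" by blast
      then show "p \<in> ran f" using f[of t] by (metis ranI)
    qed
    then show ?thesis
      by (rule someI[of "\<lambda>f. ran f = Map.graph n", OF trans[OF _ graph_eq_to_snd_dom[symmetric]]])
  qed
  have "(SOME f :: 'k \<Rightarrow> _. ran f = Map.graph m) = (SOME f. ran f = Map.graph m')"
    using assms(3) unfolding node_def by (rule tree.inject[THEN iffD1])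
  then have "Map.graph m = Map.graph m'"
    using enum[OF assms(1)] enum[OF assms(2)] by (metis (no_types))
  moreover have "m x = Some y \<longleftrightarrow> (x, y) \<in> Map.graph m" for m :: "('k, 'q) tree \<rightharpoonup> 'q" and x y
    by (auto simp: Map.graph_def)
  ultimately have "m x = Some y \<longleftrightarrow> m' x = Some y" for x y
    by simp
  then have "m x = m' x" for x
    by (metis not_None_eq)
  then show ?thesis
    by (rule ext)
qed

context
  fixes lift :: "(('k, 'q) hfun \<rightharpoonup> 'q) \<Rightarrow> (('k, 'q) tree \<rightharpoonup> 'q)"
  defines "lift \<equiv> \<lambda>m t. if t \<in> canonical then m (Abs_hfun t) else None"
begin

private lemma dom_lift: "dom (lift m) = Rep_hfun ` dom m"
proof -
  have "t \<in> Rep_hfun ` dom m" if "t \<in> canonical" "m (Abs_hfun t) = Some y" for t y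
    using that Abs_hfun_inverse[of t] by (metis imageI domI)
  then show ?thesis
    by (auto simp: lift_def Rep_hfun Rep_hfun_inverse split: if_splits)
qed

private lemma lift_small:
  assumes "dom m \<lesssim> (UNIV :: 'k set)" shows "dom (lift m) \<lesssim> (UNIV :: 'k set)"
  unfolding dom_lift by (rule lepoll_trans[OF image_lepoll assms])

private lemma lift_canonical:
  assumes "dom m \<lesssim> (UNIV :: 'k set)" shows "node (lift m) \<in> canonical"
  by (rule canonical.intros) (use assms lift_small in \<open>auto simp: lift_def split: if_splits\<close>)

private lemma Fn_lift: "Fn m = Abs_hfun (node (lift m))"
  by (simp add: Fn_def lift_def)

lemma Fn_inject:
  fixes m m' :: "('k, 'q) hfun \<rightharpoonup> 'q"
  assumes "dom m \<lesssim> (UNIV :: 'k set)" "dom m' \<lesssim> (UNIV :: 'k set)" "Fn m = Fn m'"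
  shows "m = m'"
proof
  fix u
  have "lift m = lift m'"
    using assms lift_canonical lift_small by (metis Fn_lift Abs_hfun_inject node_inject)
  then have "lift m (Rep_hfun u) = lift m' (Rep_hfun u)" by simp
  then show "m u = m' u"
    by (simp add: lift_def Rep_hfun Rep_hfun_inverse)
qed

lemma fn_Fn:
  fixes m :: "('k, 'q) hfun \<rightharpoonup> 'q"
  assumes "dom m \<lesssim> (UNIV :: 'k set)" shows "fn (Fn m) = m"
  unfolding fn_def using assms Fn_inject by (intro the_equality) auto

lemma hfun_induct:
  fixes u :: "('k, 'q) hfun"
  assumes "\<And>m. \<lbrakk>dom m \<lesssim> (UNIV :: 'k set); \<And>x. x \<in> dom m \<Longrightarrow> P x\<rbrakk> \<Longrightarrow> P (Fn m)"
  shows "P u"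
proof -
  have "P (Abs_hfun t)" if "t \<in> canonical" for t
    using that
  proof (induction rule: canonical.induct)
    case (1 m)
    define m' where "m' = (\<lambda>v. m (Rep_hfun v))"
    have m: "lift m' = m"
    proof
      fix t show "lift m' t = m t"
        using 1(1) by (cases "t \<in> canonical"; cases "m t") (auto simp: lift_def m'_def Abs_hfun_inverse)
    qed
    have "dom m' \<lesssim> dom m"
      by (rule lepoll_def[THEN meta_eq_to_obj_eq, THEN iffD2], rule exI[of _ Rep_hfun])
        (auto simp: m'_def inj_on_def Rep_hfun_inject)
    then have "dom m' \<lesssim> (UNIV :: 'k set)"
      using 1(2) lepoll_trans by blast
    moreover have "P x" if "x \<in> dom m'" for x
      using 1(1)[rule_format, of "Rep_hfun x"] that by (auto simp: m'_def Rep_hfun_inverse)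
    ultimately have "P (Fn m')" by (rule assms)
    then show ?case by (simp add: Fn_lift m)
  qed
  then show ?thesis
    by (metis Rep_hfun Rep_hfun_inverse)
qed

end

lemma Fn_fn: "Fn (fn u) = u"
  by (induction u rule: hfun_induct) (simp add: fn_Fn)

lemma small_dom: "dom (fn (u :: ('k, 'q) hfun)) \<lesssim> (UNIV :: 'k set)"
  by (induction u rule: hfun_induct) (simp add: fn_Fn)

definition mem_dom :: "(('k, 'q) hfun \<times> ('k, 'q) hfun) set" where
  "mem_dom = {(x, u). x \<in> dom (fn u)}"

lemma wf_mem_dom: "wf mem_dom"
proof (rule wfUNIVI)
  fix P :: "('a, 'b) hfun \<Rightarrow> bool" and u
  assume *: "\<forall>u. (\<forall>x. (x, u) \<in> mem_dom \<longrightarrow> P x) \<longrightarrow> P u"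
  show "P u"
    by (induction u rule: hfun_induct) (use * in \<open>auto simp: mem_dom_def fn_Fn\<close>)
qed

abbreviation val :: "('k, 'q) hfun \<Rightarrow> ('k, 'q) hfun \<Rightarrow> 'q" where
  "val u x \<equiv> the (fn u x)"

text \<open>A function into the one-element type is just a set: \<open>('k, unit) hfun\<close> is the
  corresponding universe of pure sets, with \<open>w \<in> dom (fn v)\<close> as membership.\<close>

type_synonym 'k pset = "('k, unit) hfun"

text \<open>\<open>check v\<close> is the function with domain \<open>{check w | w \<in> v}\<close> and constant value 1.\<close>

function check :: "'k pset \<Rightarrow> ('k, 'q::top) hfun" where
  "check v = Fn (\<lambda>x. if x \<in> check ` dom (fn v) then Some \<top> else None)"
  by pat_completeness auto
termination
  by (relation mem_dom) (simp_all add: wf_mem_dom, simp add: mem_dom_def)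

declare check.simps [simp del]

lemma dom_const_on: "dom (\<lambda>x. if x \<in> A then Some c else None) = A"
  by (auto split: if_splits)

lemma fn_check:
  "fn (check v :: ('k, 'q::top) hfun) = (\<lambda>x. if x \<in> check ` dom (fn v) then Some \<top> else None)"
proof -
  have "check ` dom (fn v) \<lesssim> (UNIV :: 'k set)"
    by (rule lepoll_trans[OF image_lepoll small_dom])
  then show ?thesis
    by (subst check.simps, intro fn_Fn) (simp only: dom_const_on)
qed


section \<open>The universe over a logic and its truth values\<close>

text \<open>The union of the cumulative hierarchy, as the least class containing every function with values
  in \<open>\<Q>\<close> whose domain is included in it.\<close>

inductive_set V :: "'q set \<Rightarrow> ('k, 'q) hfun set" for \<Q> :: "'q set" where
  "\<lbrakk>\<forall>x\<in>dom (fn u). x \<in> V \<Q>; ran (fn u) \<subseteq> \<Q>\<rbrakk> \<Longrightarrow> u \<in> V \<Q>"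

function
  tv_eq :: "('k, 'h::complex_hilbert_space proj) hfun \<Rightarrow> ('k, 'h proj) hfun \<Rightarrow> 'h proj" and
  tv_mem :: "('k, 'h proj) hfun \<Rightarrow> ('k, 'h proj) hfun \<Rightarrow> 'h proj" where
  "tv_eq u v = (\<Sqinter>u'\<in>dom (fn u). val u u' \<rightarrow>\<^sub>Q tv_mem u' v)
    \<sqinter> (\<Sqinter>v'\<in>dom (fn v). val v v' \<rightarrow>\<^sub>Q tv_mem v' u)"
| "tv_mem u v = (\<Squnion>v'\<in>dom (fn v). val v v' \<sqinter> tv_eq u v')"
  by pat_completeness auto
termination
proof (relation "inv_image (mult mem_dom) (case_sum (\<lambda>(u, v). {#u, v#}) (\<lambda>(u, v). {#u, v#}))", goal_cases)
  case 1
  show ?case by (intro wf_inv_image wf_mult wf_mem_dom)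
next
  have step: "({#w, x#}, {#w, u#}) \<in> mult mem_dom" if "x \<in> dom (fn u)" for x u w :: "('k, 'h proj) hfun"
    using that one_step_implies_mult[of "{#u#}" "{#x#}" mem_dom "{#w#}"]
    by (simp add: mem_dom_def add_mset_commute[of w])
  have swap: "{#a, b#} = {#b, a#}" for a b :: "('k, 'h proj) hfun"
    by (rule add_mset_commute)
  {
    case (2 u v x) then show ?case
      using step[of x u v] by (simp add: swap[of _ v])
  next
    case (3 u v x) then show ?case
      using step[of x v u] by (simp add: swap[of x u])
  next
    case (4 u v x) then show ?case
      using step[of x v u] by simp
  }
qed

declare tv_eq.simps [simp del] tv_mem.simps [simp del]

text \<open>Bounded sentences with parameters of type \<open>'n\<close>. In \<open>\<^bold>\<forall>x\<^bold>\<in>u. \<phi> x\<close> the body is the function that maps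
  a parameter \<open>u'\<close> to the sentence \<open>\<phi>(u')\<close>.\<close>

datatype 'n fm =
    Eq 'n 'n (infix "\<^bold>=" 50)
  | Mem 'n 'n (infix "\<^bold>\<in>" 50)
  | Less 'n 'n (infix "\<^bold><" 50)
  | Neg "'n fm" ("\<^bold>\<not> _" [40] 40)
  | And "'n fm" "'n fm" (infixr "\<^bold>\<and>" 35)
  | Or "'n fm" "'n fm" (infixr "\<^bold>\<or>" 30)
  | Imp "'n fm" "'n fm" (infixr "\<^bold>\<longrightarrow>" 25)
  | Iff "'n fm" "'n fm" (infix "\<^bold>\<longleftrightarrow>" 24)
  | BAll 'n "'n \<Rightarrow> 'n fm"
  | BEx 'n "'n \<Rightarrow> 'n fm"

syntax
  "_BAll" :: "pttrn \<Rightarrow> 'n \<Rightarrow> 'n fm \<Rightarrow> 'n fm" ("(3\<^bold>\<forall>_\<^bold>\<in>_./ _)" [0, 0, 10] 10)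
  "_BEx" :: "pttrn \<Rightarrow> 'n \<Rightarrow> 'n fm \<Rightarrow> 'n fm" ("(3\<^bold>\<exists>_\<^bold>\<in>_./ _)" [0, 0, 10] 10)
translations
  "\<^bold>\<forall>x\<^bold>\<in>u. \<phi>" == "CONST BAll u (\<lambda>x. \<phi>)"
  "\<^bold>\<exists>x\<^bold>\<in>u. \<phi>" == "CONST BEx u (\<lambda>x. \<phi>)"

definition Subseteq :: "'n \<Rightarrow> 'n \<Rightarrow> 'n fm" (infix "\<^bold>\<subseteq>" 50) where
  "x \<^bold>\<subseteq> y = (\<^bold>\<forall>z\<^bold>\<in>x. z \<^bold>\<in> y)"

text \<open>Throughout, \<open>q\<close> is an encoding of the rational numbers as pure sets; it matters for the
  order of the rationals, which is a primitive symbol.\<close>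

definition tv_less ::
  "(rat \<Rightarrow> 'k pset) \<Rightarrow> ('k, 'h::complex_hilbert_space proj) hfun \<Rightarrow> ('k, 'h proj) hfun \<Rightarrow> 'h proj" where
  "tv_less q u v = (if \<exists>r s. u = check (q r) \<and> v = check (q s) \<and> r < s then \<top> else \<bottom>)"

primrec tv :: "(rat \<Rightarrow> 'k pset) \<Rightarrow> ('k, 'h::complex_hilbert_space proj) hfun fm \<Rightarrow> 'h proj" where
  "tv q (u \<^bold>= v) = tv_eq u v"
| "tv q (u \<^bold>\<in> v) = tv_mem u v"
| "tv q (u \<^bold>< v) = tv_less q u v"
| "tv q (\<^bold>\<not> \<phi>) = - tv q \<phi>"
| "tv q (\<phi> \<^bold>\<and> \<psi>) = tv q \<phi> \<sqinter> tv q \<psi>"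
| "tv q (\<phi> \<^bold>\<or> \<psi>) = tv q \<phi> \<squnion> tv q \<psi>"
| "tv q (\<phi> \<^bold>\<longrightarrow> \<psi>) = (tv q \<phi> \<rightarrow>\<^sub>Q tv q \<psi>)"
| "tv q (\<phi> \<^bold>\<longleftrightarrow> \<psi>) = (tv q \<phi> \<leftrightarrow>\<^sub>Q tv q \<psi>)"
| "tv q (BAll u \<phi>) = (\<Sqinter>u'\<in>dom (fn u). val u u' \<rightarrow>\<^sub>Q tv q (\<phi> u'))"
| "tv q (BEx u \<phi>) = (\<Squnion>u'\<in>dom (fn u). val u u' \<sqinter> tv q (\<phi> u'))"


section \<open>Real numbers\<close>

definition rat_check :: "(rat \<Rightarrow> 'k pset) \<Rightarrow> ('k, 'q::top) hfun" where
  "rat_check q = check (Fn (\<lambda>w. if w \<in> range q then Some () else None))"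

definition is_real ::
  "(rat \<Rightarrow> 'k pset) \<Rightarrow> ('k, 'h::complex_hilbert_space proj) hfun \<Rightarrow> ('k, 'h proj) hfun fm" where
  "is_real q x = (x \<^bold>\<subseteq> rat_check q
     \<^bold>\<and> (\<^bold>\<exists>y\<^bold>\<in>rat_check q. y \<^bold>\<in> x)
     \<^bold>\<and> (\<^bold>\<exists>y\<^bold>\<in>rat_check q. \<^bold>\<not> y \<^bold>\<in> x)
     \<^bold>\<and> (\<^bold>\<forall>y\<^bold>\<in>rat_check q. y \<^bold>\<in> x \<^bold>\<longleftrightarrow> (\<^bold>\<forall>z\<^bold>\<in>rat_check q. y \<^bold>< z \<^bold>\<longrightarrow> z \<^bold>\<in> x)))"

definition reals ::
  "'h::complex_hilbert_space proj set \<Rightarrow> (rat \<Rightarrow> 'k pset) \<Rightarrow> ('k, 'h proj) hfun set" where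
  "reals \<Q> q = {u \<in> V \<Q>. dom (fn u) = {check (q r) | r. True} \<and> tv q (is_real q u) = \<top>}"

definition Reals_name ::
  "'h::complex_hilbert_space proj set \<Rightarrow> (rat \<Rightarrow> 'k pset) \<Rightarrow> ('k, 'h proj) hfun" where
  "Reals_name \<Q> q = Fn (\<lambda>u. if u \<in> reals \<Q> q then Some \<top> else None)"

text \<open>The index type must be large enough for \<^const>\<open>rat_check\<close> and \<^const>\<open>Reals_name\<close> to have the
  intended domains. The following one is, for any \<open>'i\<close>; as \<open>'i\<close> is arbitrary, the universe may be
  taken as large as desired.\<close>

type_synonym ('i, 'h) idx = "'i + (rat \<times> 'h proj) set"

lemma fn_Reals_name:
  fixes \<Q> :: "'h::complex_hilbert_space proj set" and q :: "rat \<Rightarrow> ('i, 'h) idx pset"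
  shows "fn (Reals_name \<Q> q) = (\<lambda>u. if u \<in> reals \<Q> q then Some \<top> else None)"
proof -
  define e where
    "e u = (Inr {(r, p). fn u (check (q r)) = Some p} :: ('i, 'h) idx)"
    for u :: "(('i, 'h) idx, 'h proj) hfun"
  have "u = v" if "u \<in> reals \<Q> q" "v \<in> reals \<Q> q" "e u = e v" for u v
  proof -
    have "fn u (check (q r)) = fn v (check (q r))" for r
      using \<open>e u = e v\<close> unfolding e_def by (auto simp: set_eq_iff) (metis not_Some_eq)
    moreover have "fn w x = None" if "x \<notin> range (\<lambda>r. check (q r))" "w \<in> reals \<Q> q" for w x
    proof -
      have "dom (fn w) = {check (q r) | r. True}"
        using that(2) by (simp add: reals_def)
      with that(1) have "x \<notin> dom (fn w)" by auto
      then show ?thesis by (simp add: domIff)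
    qed
    ultimately have "fn u x = fn v x" for x
      using that(1,2) by (cases "x \<in> range (\<lambda>r. check (q r))") auto
    then have "fn u = fn v" by (rule ext)
    then show ?thesis using Fn_fn by metis
  qed
  then have "inj_on e (reals \<Q> q)"
    by (auto simp: inj_on_def)
  then have "reals \<Q> q \<lesssim> (UNIV :: ('i, 'h) idx set)"
    by (auto simp: lepoll_def)
  then show ?thesis
    unfolding Reals_name_def by (intro fn_Fn) (simp only: dom_const_on)
qed

lemma dom_rat_check:
  fixes q :: "rat \<Rightarrow> ('i, 'h::complex_hilbert_space) idx pset"
  shows "dom (fn (rat_check q :: (('i, 'h) idx, 'q::top) hfun)) = {check (q r) | r. True}"
proof -
  have "inj (\<lambda>r. Inr {(r, undefined)} :: ('i, 'h) idx)"
    by (auto simp: inj_def)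
  then have "(UNIV :: rat set) \<lesssim> (UNIV :: ('i, 'h) idx set)"
    by (auto simp: lepoll_def)
  then have "range q \<lesssim> (UNIV :: ('i, 'h) idx set)"
    by (rule lepoll_trans[OF image_lepoll])
  then have "fn (Fn (\<lambda>w. if w \<in> range q then Some () else None)) 
      = (\<lambda>w. if w \<in> range q then Some () else None)"
    by (intro fn_Fn) (simp only: dom_const_on)
  then show ?thesis
    by (auto simp: rat_check_def fn_check dom_const_on)
qed

end

theory Submission
  imports Defs
begin

text \<open>
  A vector \<open>x\<close> lies in the range of \<open>P \<rightarrow>\<^sub>Q Q\<close> iff \<open>Q P x = P x\<close>, hence in the range of \<open>P \<leftrightarrow>\<^sub>Q Q\<close>
  iff \<open>P x = Q x\<close>. As \<open>check r = check s\<close> only takes the values 0 and 1, the truth value of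
  \<open>check r \<in> u\<close> for a real \<open>u\<close> is just \<open>u (check r)\<close>. So \<open>u = v\<close> has as its range the
  vectors on which the projections \<open>u (check r)\<close> and \<open>v (check r)\<close> agree for all \<open>r\<close>. For this
  pointwise condition the equality axioms are evident, with no commutativity assumption.
\<close>

section \<open>Closed subspaces of a complex Hilbert space\<close>

lemma cinner_add_right: "cinner x (y + z) = cinner x y + cinner x z"
  using cinner_commute[of x "y + z"] cinner_commute[of x y] cinner_commute[of x z]
  by (simp add: cinner_add_left)

lemma cinner_scaleC_right: "cinner x (c *\<^sub>C y) = cnj c * cinner x y"
  using cinner_commute[of x "c *\<^sub>C y"] cinner_commute[of x y]
  by (simp add: cinner_scaleC_left)

lemma cinner_diff_left: "cinner (x - y) z = cinner x z - cinner y z"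
  using cinner_add_left[of "x - y" y z] by simp

lemma cinner_diff_right: "cinner x (y - z) = cinner x y - cinner x z"
  using cinner_add_right[of x "y - z" z] by simp

lemmas cinner_distribs = cinner_add_left cinner_add_right cinner_diff_left cinner_diff_right

lemma cinner_zero_left [simp]: "cinner 0 x = 0"
  using cinner_diff_left[of 0 0 x] by simp

lemma cinner_zero_right [simp]: "cinner x 0 = 0"
  using cinner_diff_right[of x 0 0] by simp

lemma norm_square_cinner: "(norm x)\<^sup>2 = Re (cinner x x)"
  by (simp add: cinner_self)

lemma cinner_self_eq_0 [simp]: "cinner x x = 0 \<longleftrightarrow> x = 0"
  by (simp add: cinner_self)

lemma cinner_eq_0_commute: "cinner x y = 0 \<longleftrightarrow> cinner y x = 0"
  using cinner_commute[of x y] by simp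

lemma norm_scaleC: "norm (c *\<^sub>C x) = cmod c * norm x"
proof -
  have "cinner (c *\<^sub>C x) (c *\<^sub>C x) = (c * cnj c) * cinner x x"
    by (simp add: cinner_scaleC_left cinner_scaleC_right)
  then have "complex_of_real ((norm (c *\<^sub>C x))\<^sup>2) = complex_of_real ((cmod c * norm x)\<^sup>2)"
    by (simp only: cinner_self complex_norm_square[symmetric] of_real_mult power_mult_distrib)
  then have "(norm (c *\<^sub>C x))\<^sup>2 = (cmod c * norm x)\<^sup>2"
    by (simp only: of_real_eq_iff)
  then show ?thesis
    by (rule power2_eq_imp_eq) simp_all
qed

lemma parallelogram_law:
  "(norm (x + y))\<^sup>2 + (norm (x - y))\<^sup>2 = 2 * (norm x)\<^sup>2 + 2 * (norm y)\<^sup>2"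
  for x y :: "'a::complex_hilbert_space"
  by (simp add: norm_square_cinner cinner_distribs)

lemma scaleR_scaleC: "r *\<^sub>R x = complex_of_real r *\<^sub>C x"
  by (simp add: scaleC_of_real)

lemma bounded_linear_scaleC: "bounded_linear (\<lambda>x. c *\<^sub>C x)"
proof
  show "\<exists>K. \<forall>x. norm (c *\<^sub>C x) \<le> norm x * K"
    by (rule exI[of _ "cmod c"]) (simp add: norm_scaleC)
qed (simp_all add: scaleC_add_right scaleR_scaleC scaleC_scaleC mult.commute)

abbreviation csubspace :: "'a::complex_hilbert_space set \<Rightarrow> bool" where
  "csubspace \<equiv> complex_vector.subspace"

lemma csubspace_closure:
  assumes "csubspace S"
  shows "csubspace (closure S)"
proof (rule complex_vector.subspaceI)
  show "0 \<in> closure S"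
    using complex_vector.subspace_0[OF assms] closure_subset by blast
next
  fix x y assume "x \<in> closure S" "y \<in> closure S"
  then obtain f g where "\<And>n. f n \<in> S" "f \<longlonglongrightarrow> x" "\<And>n. g n \<in> S" "g \<longlonglongrightarrow> y"
    unfolding closure_sequential by blast
  then show "x + y \<in> closure S"
    unfolding closure_sequential
    by (intro exI[of _ "\<lambda>n. f n + g n"]) (auto intro: tendsto_add complex_vector.subspace_add assms)
next
  fix c x assume "x \<in> closure S"
  then obtain f where "\<And>n. f n \<in> S" "f \<longlonglongrightarrow> x"
    unfolding closure_sequential by blast
  then show "c *\<^sub>C x \<in> closure S"
    unfolding closure_sequential
    by (intro exI[of _ "\<lambda>n. c *\<^sub>C f n"])
      (auto intro: bounded_linear.tendsto[OF bounded_linear_scaleC] complex_vector.subspace_scale assms)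
qed

text \<open>A sequence in \<open>S\<close> whose squared distances to \<open>x\<close> approach
  their infimum \<open>d\<close> is Cauchy: the midpoint of two terms lies in \<open>S\<close>,
  hence has squared distance at least \<open>d\<close>, and the parallelogram law then bounds the
  distance of the two terms. Completeness gives a limit, closedness of \<open>S\<close> keeps it in
  \<open>S\<close>.\<close>

lemma nearest_point_exists:
  fixes S :: "'a::complex_hilbert_space set"
  assumes S: "closed S" "csubspace S"
  obtains m where "m \<in> S" "\<And>s. s \<in> S \<Longrightarrow> norm (x - m) \<le> norm (x - s)"
proof -
  define D where "D = (\<lambda>s. (norm (x - s))\<^sup>2) ` S"
  define d where "d = Inf D"
  have "S \<noteq> {}" using complex_vector.subspace_0[OF S(2)] by blast
  then have D: "D \<noteq> {}" "bdd_below D" by (auto simp: D_def intro: bdd_belowI[of _ 0])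
  have d_le: "d \<le> (norm (x - s))\<^sup>2" if "s \<in> S" for s
    unfolding d_def by (rule cInf_lower) (use that D in \<open>auto simp: D_def\<close>)
  have "\<exists>s\<in>S. (norm (x - s))\<^sup>2 < d + 1 / real (Suc n)" for n
    using cInf_lessD[OF D(1), of "d + 1 / real (Suc n)"] by (auto simp: d_def D_def)
  then obtain s where s: "\<And>n. s n \<in> S" "\<And>n. (norm (x - s n))\<^sup>2 < d + 1 / real (Suc n)"
    by metis
  have diff: "(norm (s m - s n))\<^sup>2 \<le> 2 / real (Suc m) + 2 / real (Suc n)" for m n
  proof -
    let ?c = "(1/2) *\<^sub>R (s m + s n)"
    have c: "?c \<in> S"
      unfolding scaleR_scaleC
      by (intro complex_vector.subspace_scale complex_vector.subspace_add S s)
    have "(x - s m) + (x - s n) = 2 *\<^sub>R (x - ?c)"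
      by (simp add: scaleR_2 scaleR_diff_right)
    then have "(norm ((x - s m) + (x - s n)))\<^sup>2 = 4 * (norm (x - ?c))\<^sup>2"
      by (simp only: norm_scaleR power_mult_distrib) simp
    moreover have "norm ((x - s m) - (x - s n)) = norm (s m - s n)"
      by (simp add: norm_minus_commute)
    ultimately show ?thesis
      using parallelogram_law[of "x - s m" "x - s n"] d_le[OF c] s(2)[of m] s(2)[of n] by simp
  qed
  have "Cauchy s"
  proof (rule metric_CauchyI)
    fix e :: real assume "e > 0"
    \<comment> \<open>Each of the two summands in \<open>diff\<close> is then below
      \<open>e\<^sup>2 / 2\<close>.\<close>
    obtain N where N: "inverse (real (Suc N)) < e\<^sup>2 / 4"
      using reals_Archimedean[of "e\<^sup>2 / 4"] \<open>e > 0\<close> by auto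
    have "dist (s m) (s n) < e" if "m \<ge> N" "n \<ge> N" for m n
    proof -
      have "1 / real (Suc k) \<le> inverse (real (Suc N))" if "k \<ge> N" for k
        using that by (simp add: field_simps)
      from this[OF \<open>m \<ge> N\<close>] this[OF \<open>n \<ge> N\<close>] have "(norm (s m - s n))\<^sup>2 < e\<^sup>2"
        using diff[of m n] N by simp
      then show ?thesis
        using \<open>e > 0\<close> by (simp add: dist_norm power2_less_imp_less)
    qed
    then show "\<exists>M. \<forall>m\<ge>M. \<forall>n\<ge>M. dist (s m) (s n) < e" by blast
  qed
  then obtain l where l: "s \<longlonglongrightarrow> l"
    using Cauchy_convergent convergent_def by blast
  have "l \<in> S"
    using closed_sequentially[OF S(1) s(1) l] .
  have "(norm (x - l))\<^sup>2 \<le> d + 0"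
  proof (rule LIMSEQ_le)
    show "(\<lambda>n. (norm (x - s n))\<^sup>2) \<longlonglongrightarrow> (norm (x - l))\<^sup>2"
      by (intro tendsto_intros l)
    show "(\<lambda>n. d + 1 / real (Suc n)) \<longlonglongrightarrow> d + 0"
      using LIMSEQ_inverse_real_of_nat by (intro tendsto_intros) (simp add: inverse_eq_divide)
    show "\<exists>N. \<forall>n\<ge>N. (norm (x - s n))\<^sup>2 \<le> d + 1 / real (Suc n)"
      using s(2) less_imp_le by blast
  qed
  then have "norm (x - l) \<le> norm (x - t)" if "t \<in> S" for t
    using d_le[OF that] by (simp add: power2_le_imp_le)
  with \<open>l \<in> S\<close> show thesis by (rule that)
qed

text \<open>Take \<open>m\<close> nearest to \<open>x\<close>. If \<open>x - m\<close> had a nonzero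
  inner product with some \<open>s\<close> in \<open>S\<close>, then moving \<open>m\<close> along
  \<open>s\<close> inside \<open>S\<close> would bring it strictly closer to
  \<open>x\<close>.\<close>

lemma orthogonal_decomposition_exists:
  fixes S :: "'a::complex_hilbert_space set"
  assumes S: "closed S" "csubspace S"
  obtains m where "m \<in> S" "\<And>s. s \<in> S \<Longrightarrow> cinner (x - m) s = 0"
proof -
  obtain m where m: "m \<in> S" "\<And>s. s \<in> S \<Longrightarrow> norm (x - m) \<le> norm (x - s)"
    using nearest_point_exists[OF S] by blast
  have "cinner (x - m) s = 0" if "s \<in> S" for s
  proof (cases "s = 0")
    case False
    define a where "a = cinner (x - m) s"
    \<comment> \<open>\<open>c *\<^sub>C s\<close> is the component of \<open>x - m\<close> along
      \<open>s\<close>. Subtracting it lowers the squared norm by exactly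
      \<open>(cmod a)\<^sup>2 / (norm s)\<^sup>2\<close>, which minimality of \<open>m\<close>
      forces to be 0.\<close>
    define c where "c = a / cinner s s"
    have sn: "cinner s (x - m) = cnj a"
      using cinner_commute[of s "x - m"] by (simp add: a_def)
    have ss: "cinner s s \<noteq> 0" "cnj (cinner s s) = cinner s s"
      using False by (simp_all add: cinner_self)
    have "m + c *\<^sub>C s \<in> S"
      by (intro complex_vector.subspace_add complex_vector.subspace_scale S m that)
    then have "(norm (x - m))\<^sup>2 \<le> (norm (x - m - c *\<^sub>C s))\<^sup>2"
      using m(2)[of "m + c *\<^sub>C s"] by (simp add: diff_diff_add power_mono)
    moreover have "cinner (x - m - c *\<^sub>C s) (x - m - c *\<^sub>C s) = cinner (x - m) (x - m) - a * cnj a / cinner s s"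
    proof -
      have "cinner (x - m - c *\<^sub>C s) (x - m - c *\<^sub>C s)
          = cinner (x - m) (x - m) - cnj c * a - c * cnj a + c * cnj c * cinner s s"
        by (simp only: cinner_diff_left[of "x - m"] cinner_diff_right[of _ "x - m"]
            cinner_scaleC_left cinner_scaleC_right sn a_def[symmetric]) (simp add: algebra_simps)
      then show ?thesis
        using ss by (simp add: c_def field_simps)
    qed
    moreover have "a * cnj a / cinner s s = complex_of_real ((cmod a)\<^sup>2 / (norm s)\<^sup>2)"
      by (simp only: cinner_self complex_norm_square[symmetric] of_real_divide)
    ultimately have "(cmod a)\<^sup>2 / (norm s)\<^sup>2 \<le> 0"
      by (simp add: norm_square_cinner)
    then have "a = 0"
      using False by (simp add: divide_le_0_iff)
    then show ?thesis by (simp add: a_def)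
  qed simp
  with m(1) show thesis by (rule that)
qed

section \<open>Projections\<close>

lemma is_projection_app_proj: "is_projection (app_proj P)"
  using app_proj[of P] by simp

lemma bounded_linear_app_proj: "bounded_linear (app_proj P)"
  using is_projection_app_proj[of P] by (simp add: is_projection_def)

lemmas app_proj_add = linear_add[OF bounded_linear.linear[OF bounded_linear_app_proj]]
  and app_proj_diff = linear_diff[OF bounded_linear.linear[OF bounded_linear_app_proj]]
  and app_proj_zero = linear_0[OF bounded_linear.linear[OF bounded_linear_app_proj]]

lemma app_proj_scaleC: "app_proj P (c *\<^sub>C x) = c *\<^sub>C app_proj P x"
  using is_projection_app_proj[of P] by (simp add: is_projection_def)

lemma app_proj_idem [simp]: "app_proj P (app_proj P x) = app_proj P x"
  using is_projection_app_proj[of P] by (metis comp_apply is_projection_def)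

lemma cinner_app_proj: "cinner (app_proj P x) y = cinner x (app_proj P y)"
  using is_projection_app_proj[of P] by (simp add: is_projection_def)

lemma mem_range_proj: "x \<in> range_proj P \<longleftrightarrow> app_proj P x = x"
proof
  show "x \<in> range_proj P \<Longrightarrow> app_proj P x = x"
    by (auto simp: range_proj_def)
  show "app_proj P x = x \<Longrightarrow> x \<in> range_proj P"
    unfolding range_proj_def by (metis rangeI)
qed

lemma csubspace_range_proj: "csubspace (range_proj P)"
  by (rule complex_vector.subspaceI)
    (simp_all add: mem_range_proj app_proj_add app_proj_scaleC app_proj_zero)

lemma closed_range_proj: "closed (range_proj P)"
proof -
  have "range_proj P = {x. app_proj P x = x}"
    by (auto simp: mem_range_proj)
  then show ?thesis
    by (simp add: closed_Collect_eq linear_continuous_on bounded_linear_app_proj)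
qed

text \<open>The vector \<open>P x - Q x\<close> lies in the common range, so both projections fix
  it. Self-adjointness turns its inner product with itself into a difference of two equal
  terms.\<close>

lemma range_proj_inject:
  assumes "range_proj P = range_proj Q"
  shows "P = Q"
proof -
  have "app_proj P x = app_proj Q x" for x
  proof -
    let ?d = "app_proj P x - app_proj Q x"
    have PQ: "app_proj P y = y \<longleftrightarrow> app_proj Q y = y" for y
      using assms by (auto simp: mem_range_proj set_eq_iff)
    have "app_proj P (app_proj Q x) = app_proj Q x" "app_proj Q (app_proj P x) = app_proj P x"
      using PQ[of "app_proj Q x"] PQ[of "app_proj P x"] by simp_all
    then have "app_proj P ?d = ?d" "app_proj Q ?d = ?d"
      by (simp_all add: app_proj_diff)
    then have "cinner ?d ?d = 0"
      by (simp add: cinner_diff_left cinner_app_proj)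
    then show ?thesis by simp
  qed
  then show ?thesis
    by (metis app_proj_inject ext)
qed

text \<open>The projection sends \<open>x\<close> to its component in \<open>S\<close>. Uniqueness
  of that component yields additivity, homogeneity and the fixed points, since in each case the
  expected value is a point of \<open>S\<close> with remainder orthogonal to
  \<open>S\<close>.\<close>

lemma projection_exists:
  fixes S :: "'a::complex_hilbert_space set"
  assumes S: "closed S" "csubspace S"
  shows "\<exists>P. range_proj P = S"
proof -
  have "\<exists>m. m \<in> S \<and> (\<forall>s\<in>S. cinner (x - m) s = 0)" for x
    by (rule orthogonal_decomposition_exists[OF S, of x]) blast
  then have "\<exists>p. \<forall>x. p x \<in> S \<and> (\<forall>s\<in>S. cinner (x - p x) s = 0)"
    by (intro choice allI)
  then obtain p where p: "\<And>x. p x \<in> S" "\<And>x s. s \<in> S \<Longrightarrow> cinner (x - p x) s = 0"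
    by blast
  \<comment> \<open>The difference of two candidates lies in \<open>S\<close>; it is also the
    difference of their remainders, hence orthogonal to \<open>S\<close> and so to itself.\<close>
  have unique: "p x = m" if "m \<in> S" "\<And>s. s \<in> S \<Longrightarrow> cinner (x - m) s = 0" for x m
  proof -
    have "p x - m \<in> S"
      by (rule complex_vector.subspace_diff[OF S(2) p(1) that(1)])
    then have "cinner ((x - m) - (x - p x)) (p x - m) = 0"
      by (subst cinner_diff_left) (simp add: p(2) that(2))
    then show ?thesis by simp
  qed
  have add: "p (x + y) = p x + p y" for x y
  proof (rule unique)
    show "p x + p y \<in> S" by (intro complex_vector.subspace_add S p)
    fix s assume "s \<in> S"
    then have "cinner ((x - p x) + (y - p y)) s = 0"
      by (simp only: cinner_add_left p) simp
    then show "cinner (x + y - (p x + p y)) s = 0" by (simp only: add_diff_add)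
  qed
  have scale: "p (c *\<^sub>C x) = c *\<^sub>C p x" for c x
  proof (rule unique)
    show "c *\<^sub>C p x \<in> S" by (intro complex_vector.subspace_scale S p)
    fix s assume "s \<in> S"
    then show "cinner (c *\<^sub>C x - c *\<^sub>C p x) s = 0"
      using p(2)[of s x] by (simp add: cinner_diff_left cinner_scaleC_left)
  qed
  have fixed: "p x = x" if "x \<in> S" for x
    by (rule unique[OF that]) simp
  have selfadjoint: "cinner (p x) y = cinner x (p y)" for x y
  proof -
    have "cinner (p x) (y - p y) = 0"
      by (subst cinner_eq_0_commute) (rule p(2)[OF p(1)])
    with p(2)[OF p(1), of x y] show ?thesis
      by (simp add: cinner_diff_left cinner_diff_right)
  qed
  \<comment> \<open>Pythagoras for the orthogonal vectors \<open>x - p x\<close> and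
    \<open>p x\<close>; this supplies the bound for \<open>bounded_linear p\<close>.\<close>
  have contraction: "norm (p x) \<le> norm x" for x
  proof -
    have o: "cinner (x - p x) (p x) = 0" by (rule p(2)[OF p(1)])
    then have "cinner (p x) (x - p x) = 0" by (subst cinner_eq_0_commute)
    with o have "cinner ((x - p x) + p x) ((x - p x) + p x) = cinner (x - p x) (x - p x) + cinner (p x) (p x)"
      by (simp only: cinner_add_left cinner_add_right) simp
    then have "(norm x)\<^sup>2 = (norm (x - p x))\<^sup>2 + (norm (p x))\<^sup>2"
      by (simp add: norm_square_cinner)
    then show ?thesis
      by (simp add: power2_le_imp_le)
  qed
  have "bounded_linear p"
  proof
    show "\<exists>K. \<forall>x. norm (p x) \<le> norm x * K"
      by (rule exI[of _ 1]) (simp add: contraction)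
  qed (simp_all add: add scale scaleR_scaleC)
  then have "is_projection p"
    unfolding is_projection_def comp_def using scale fixed[OF p(1)] selfadjoint by simp
  moreover have "range p = S"
  proof
    show "range p \<subseteq> S" using p(1) by blast
    show "S \<subseteq> range p" using fixed by (metis rangeI subsetI)
  qed
  ultimately have "range_proj (Abs_proj p) = S"
    by (simp add: range_proj_def Abs_proj_inverse)
  then show ?thesis by blast
qed

text \<open>Existence comes from \<open>projection_exists\<close> and uniqueness from
  \<open>range_proj_inject\<close>, so the definite description denotes. Meets and joins can from
  here on be computed on ranges.\<close>

lemma range_proj_onto:
  assumes "closed S" "csubspace S"
  shows "range_proj (proj_onto S) = S"
  unfolding proj_onto_def
  using projection_exists[OF assms] range_proj_inject by (metis (mono_tags, lifting) theI)

section \<open>Ranges of the lattice operations\<close>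

lemma range_inf: "range_proj (P \<sqinter> Q) = range_proj P \<inter> range_proj Q"
  unfolding inf_proj_def
  by (intro range_proj_onto closed_Int complex_vector.subspace_inter closed_range_proj csubspace_range_proj)

lemma range_Inf: "range_proj (\<Sqinter>A) = (\<Inter>P\<in>A. range_proj P)"
  unfolding Inf_proj_def
  by (intro range_proj_onto closed_INT complex_vector.subspace_Inter ballI closed_range_proj)
    (auto simp: csubspace_range_proj)

lemma csubspace_closure_cspan: "csubspace (closure (cspan S))"
  by (intro csubspace_closure complex_vector.subspace_span)

lemma range_sup: "range_proj (P \<squnion> Q) = closure (cspan (range_proj P \<union> range_proj Q))"
  unfolding sup_proj_def by (intro range_proj_onto closed_closure csubspace_closure_cspan)

lemma range_Sup: "range_proj (\<Squnion>A) = closure (cspan (\<Union>P\<in>A. range_proj P))"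
  unfolding Sup_proj_def by (intro range_proj_onto closed_closure csubspace_closure_cspan)

lemma closure_cspan_base: "x \<in> S \<Longrightarrow> x \<in> closure (cspan S)"
  using complex_vector.span_superset closure_subset by blast

lemma closure_cspan_minimal:
  assumes "S \<subseteq> T" "closed T" "csubspace T"
  shows "closure (cspan S) \<subseteq> T"
  using assms by (intro closure_minimal complex_vector.span_minimal)

lemma app_top [simp]: "app_proj \<top> x = x"
  unfolding top_proj_def
  by (subst Abs_proj_inverse) (simp_all add: is_projection_def bounded_linear_ident comp_def)

lemma range_top: "range_proj \<top> = UNIV"
  by (auto simp: mem_range_proj)

lemma app_bot [simp]: "app_proj \<bottom> x = 0"
  unfolding bot_proj_def
  by (subst Abs_proj_inverse) (simp_all add: is_projection_def bounded_linear_zero comp_def)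

lemma app_uminus: "app_proj (- P) x = x - app_proj P x"
proof -
  have "is_projection (\<lambda>x. x - app_proj P x)"
    by (auto simp: is_projection_def comp_def cinner_diff_left cinner_diff_right cinner_app_proj
        app_proj_diff app_proj_scaleC complex_vector.scale_right_diff_distrib
        intro: bounded_linear_sub bounded_linear_ident bounded_linear_app_proj)
  then show ?thesis
    unfolding uminus_proj_def by (subst Abs_proj_inverse) simp_all
qed

text \<open>Order and equality are those of the ranges, intersections are greatest lower bounds, and
  the closed span is the least closed subspace above a union. This makes the general facts on infima
  and suprema available for truth values.\<close>

instance proj :: (complex_hilbert_space) complete_lattice
proof
  fix P Q R :: "'a proj" and A :: "'a proj set"
  show "P < Q \<longleftrightarrow> P \<le> Q \<and> \<not> Q \<le> P"
    by (auto simp: less_proj_def less_eq_proj_def)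
  show "P \<le> P" by (simp add: less_eq_proj_def)
  show "P \<le> Q \<Longrightarrow> Q \<le> R \<Longrightarrow> P \<le> R" by (auto simp: less_eq_proj_def)
  show "P \<le> Q \<Longrightarrow> Q \<le> P \<Longrightarrow> P = Q" by (auto simp: less_eq_proj_def intro: range_proj_inject)
  show "P \<sqinter> Q \<le> P" "P \<sqinter> Q \<le> Q" by (auto simp: less_eq_proj_def range_inf)
  show "P \<le> Q \<Longrightarrow> P \<le> R \<Longrightarrow> P \<le> Q \<sqinter> R" by (auto simp: less_eq_proj_def range_inf)
  show "P \<le> P \<squnion> Q" "Q \<le> P \<squnion> Q"
    by (auto simp: less_eq_proj_def range_sup intro: closure_cspan_base)
  show "Q \<le> P \<Longrightarrow> R \<le> P \<Longrightarrow> Q \<squnion> R \<le> P"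
    unfolding less_eq_proj_def range_sup
    by (intro closure_cspan_minimal closed_range_proj csubspace_range_proj) auto
  show "P \<in> A \<Longrightarrow> \<Sqinter>A \<le> P" by (auto simp: less_eq_proj_def range_Inf)
  show "(\<And>Q. Q \<in> A \<Longrightarrow> P \<le> Q) \<Longrightarrow> P \<le> \<Sqinter>A" by (auto simp: less_eq_proj_def range_Inf)
  show "P \<in> A \<Longrightarrow> P \<le> \<Squnion>A"
    by (auto simp: less_eq_proj_def range_Sup intro: closure_cspan_base)
  show "(\<And>Q. Q \<in> A \<Longrightarrow> Q \<le> P) \<Longrightarrow> \<Squnion>A \<le> P"
    unfolding less_eq_proj_def range_Sup
    by (intro closure_cspan_minimal closed_range_proj csubspace_range_proj) auto
  show "\<Sqinter>({} :: 'a proj set) = \<top>"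
    by (rule range_proj_inject) (auto simp: range_Inf mem_range_proj)
  show "\<Squnion>({} :: 'a proj set) = \<bottom>"
    by (rule range_proj_inject) (auto simp: range_Sup mem_range_proj)
qed

section \<open>The Sasaki implication\<close>

text \<open>The vectors satisfying the equation form a closed subspace that contains the ranges of
  \<open>- P\<close> and of \<open>P \<sqinter> Q\<close>, hence their closed span. Conversely
  \<open>x = (x - P x) + P x\<close> splits such a vector into one summand from each of these
  ranges.\<close>

lemma mem_range_imp:
  "x \<in> range_proj (P \<rightarrow>\<^sub>Q Q) \<longleftrightarrow> app_proj Q (app_proj P x) = app_proj P x"
proof
  let ?T = "{x. app_proj Q (app_proj P x) = app_proj P x}"
  have "csubspace ?T"
    by (rule complex_vector.subspaceI) (simp_all add: app_proj_add app_proj_scaleC app_proj_zero)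
  moreover have "closed ?T"
    by (intro closed_Collect_eq linear_continuous_on bounded_linear_app_proj
        bounded_linear_compose[OF bounded_linear_app_proj bounded_linear_app_proj])
  moreover have "range_proj (- P) \<union> range_proj (P \<sqinter> Q) \<subseteq> ?T"
    by (auto simp: range_inf mem_range_proj app_uminus app_proj_zero)
  ultimately have "range_proj (P \<rightarrow>\<^sub>Q Q) \<subseteq> ?T"
    unfolding imp_def range_sup by (intro closure_cspan_minimal)
  then show "x \<in> range_proj (P \<rightarrow>\<^sub>Q Q) \<Longrightarrow> app_proj Q (app_proj P x) = app_proj P x" by blast
next
  assume "app_proj Q (app_proj P x) = app_proj P x"
  then have "app_proj P x \<in> range_proj (P \<sqinter> Q)"
    by (simp add: range_inf mem_range_proj)
  moreover have "x - app_proj P x \<in> range_proj (- P)"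
    by (simp add: mem_range_proj app_uminus app_proj_diff)
  ultimately have "(x - app_proj P x) + app_proj P x \<in> range_proj (P \<rightarrow>\<^sub>Q Q)"
    unfolding imp_def range_sup
    by (intro complex_vector.subspace_add csubspace_closure_cspan closure_cspan_base) simp_all
  then show "x \<in> range_proj (P \<rightarrow>\<^sub>Q Q)" by simp
qed

text \<open>By \<open>mem_range_imp\<close> the implication is \<open>\<top>\<close> iff
  \<open>Q\<close> fixes every \<open>P x\<close>. Validity of an implication thereby becomes an
  inequality of truth values.\<close>

lemma imp_eq_top_iff: "(P \<rightarrow>\<^sub>Q Q) = \<top> \<longleftrightarrow> P \<le> Q"
proof -
  have "(P \<rightarrow>\<^sub>Q Q) = \<top> \<longleftrightarrow> (\<forall>x. x \<in> range_proj (P \<rightarrow>\<^sub>Q Q))"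
  proof
    assume "\<forall>x. x \<in> range_proj (P \<rightarrow>\<^sub>Q Q)"
    then have "range_proj (P \<rightarrow>\<^sub>Q Q) = range_proj \<top>"
      unfolding range_top by blast
    then show "(P \<rightarrow>\<^sub>Q Q) = \<top>" by (rule range_proj_inject)
  qed (simp add: range_top)
  also have "\<dots> \<longleftrightarrow> range (app_proj P) \<subseteq> range_proj Q"
    by (simp add: mem_range_imp mem_range_proj[of _ Q] image_subset_iff)
  also have "\<dots> \<longleftrightarrow> P \<le> Q"
    by (simp only: less_eq_proj_def range_proj_def)
  finally show ?thesis .
qed

lemma top_imp [simp]: "(\<top> \<rightarrow>\<^sub>Q P) = P"
  by (intro range_proj_inject set_eqI) (simp only: mem_range_imp app_top mem_range_proj[of _ P])

text \<open>Write p for \<open>P x\<close> and q for \<open>Q x\<close>. The two implications say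
  that \<open>Q\<close> fixes p and \<open>P\<close> fixes q; by self-adjointness <p,q> = <p,x> =
  <p,p> and <q,p> = <q,x> = <q,q>. Expanding the squared norm of p - q then gives 0.\<close>

lemma mem_range_iff:
  "x \<in> range_proj (P \<leftrightarrow>\<^sub>Q Q) \<longleftrightarrow> app_proj P x = app_proj Q x"
proof
  let ?p = "app_proj P x" and ?q = "app_proj Q x"
  assume "x \<in> range_proj (P \<leftrightarrow>\<^sub>Q Q)"
  then have *: "app_proj Q ?p = ?p" "app_proj P ?q = ?q"
    by (simp_all add: iff_def range_inf mem_range_imp)
  have "cinner ?p ?q = cinner ?p ?p"
    unfolding cinner_app_proj[of Q ?p x, symmetric] cinner_app_proj[of P ?p x, symmetric] * by simp
  moreover have "cinner ?q ?p = cinner ?q ?q"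
    unfolding cinner_app_proj[of P ?q x, symmetric] cinner_app_proj[of Q ?q x, symmetric] * by simp
  ultimately have "cinner (?p - ?q) (?p - ?q) = 0"
    by (simp only: cinner_diff_left cinner_diff_right) simp
  then show "?p = ?q" by simp
next
  assume *: "app_proj P x = app_proj Q x"
  then show "x \<in> range_proj (P \<leftrightarrow>\<^sub>Q Q)"
    by (simp add: iff_def range_inf mem_range_imp *) (simp flip: *)
qed

section \<open>Truth values of atomic sentences\<close>

text \<open>Exchanging the arguments only swaps the two meets in the recursive clause.\<close>

lemma tv_eq_commute: "tv_eq u v = tv_eq v u"
  by (simp add: tv_eq.simps[of u v] tv_eq.simps[of v u] inf_commute)

lemma dom_check: "dom (fn (check v :: ('k, 'q::top) hfun)) = check ` dom (fn v)"
  by (simp only: fn_check dom_const_on)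

lemma val_check:
  "x \<in> dom (fn v) \<Longrightarrow> val (check v :: ('k, 'q::top) hfun) (check x) = \<top>"
  by (simp add: fn_check)

lemma tv_mem_check:
  "tv_mem u (check w) = (\<Squnion>w'\<in>dom (fn w). tv_eq u (check w'))"
  unfolding tv_mem.simps[of u "check w"] dom_check image_image
  by (intro SUP_cong refl) (simp add: val_check)

lemma tv_eq_check_check:
  "tv_eq (check v) (check w) =
    (\<Sqinter>v'\<in>dom (fn v). tv_mem (check v') (check w)) \<sqinter> (\<Sqinter>w'\<in>dom (fn w). tv_mem (check w') (check v))"
  unfolding tv_eq.simps[of "check v"] dom_check image_image
  by (intro arg_cong2[where f = inf] INF_cong refl) (simp_all add: val_check)

text \<open>Extensionality of pure sets: with values in the one-element type, a function is
  determined by its domain.\<close>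

lemma pset_eqI:
  fixes v w :: "'k pset"
  assumes "dom (fn v) = dom (fn w)"
  shows "v = w"
proof -
  have "fn v x = fn w x" for x
    using assms domIff[of x "fn v"] domIff[of x "fn w"] by (cases "fn v x"; cases "fn w x") auto
  then show ?thesis
    by (metis Fn_fn ext)
qed

text \<open>On two-valued families join and meet act as the classical quantifiers. This lemma and
  the next serve to evaluate sentences about check names.\<close>

lemma SUP_top_bot:
  "(\<Squnion>a\<in>A. if P a then \<top> else \<bottom>) = (if \<exists>a\<in>A. P a then \<top> else (\<bottom> :: 'b::complete_lattice))"
proof (cases "\<exists>a\<in>A. P a")
  case True
  then obtain a where "a \<in> A" "P a" by blast
  then have "\<top> \<le> (\<Squnion>a\<in>A. if P a then \<top> else (\<bottom> :: 'b))"
    by (intro SUP_upper2[of a]) simp_all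
  with True show ?thesis by (simp only: top_le if_True)
qed (simp cong: SUP_cong)

lemma INF_top_bot:
  "(\<Sqinter>a\<in>A. if P a then \<top> else \<bottom>) = (if \<forall>a\<in>A. P a then \<top> else (\<bottom> :: 'b::complete_lattice))"
proof (cases "\<forall>a\<in>A. P a")
  case False
  then obtain a where "a \<in> A" "\<not> P a" by blast
  then have "(\<Sqinter>a\<in>A. if P a then \<top> else (\<bottom> :: 'b)) \<le> \<bottom>"
    by (intro INF_lower2[of a]) simp_all
  with False show ?thesis by (simp only: le_bot if_False)
qed (simp cong: INF_cong)

text \<open>By well-founded induction on \<open>v\<close>, memberships between elements of
  \<open>v\<close> and of \<open>w\<close> have value \<open>\<top>\<close> or \<open>\<bot>\<close>
  according to the actual membership; extensionality of pure sets then settles the equality.\<close>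

lemma tv_eq_check:
  "tv_eq (check v) (check w) = (if v = w then \<top> else (\<bottom> :: 'h::complex_hilbert_space proj))"
proof (induction v arbitrary: w rule: wf_induct_rule[OF wf_mem_dom])
  case (1 v)
  \<comment> \<open>The induction hypothesis has the element of \<open>v\<close> on the left. The
    flipped form is what the membership of \<open>check w'\<close> in \<open>check v\<close> calls
    for, where elements of \<open>v\<close> stand on the right.\<close>
  have eq: "tv_eq (check v') (check w) = (if v' = w then \<top> else (\<bottom> :: 'h proj))"
      "tv_eq (check w) (check v') = (if v' = w then \<top> else (\<bottom> :: 'h proj))"
    if "v' \<in> dom (fn v)" for v' w
    using 1 that by (simp_all add: mem_dom_def tv_eq_commute[of "check w"])
  have same: "(\<forall>v'\<in>dom (fn v). v' \<in> dom (fn w)) \<and> (\<forall>w'\<in>dom (fn w). w' \<in> dom (fn v)) \<longleftrightarrow> v = w"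
    using pset_eqI[of v w] by blast
  have "tv_mem (check v') (check w) = (if v' \<in> dom (fn w) then \<top> else (\<bottom> :: 'h proj))"
    if "v' \<in> dom (fn v)" for v'
    using that by (simp add: tv_mem_check eq SUP_top_bot Bex_def)
  moreover have "tv_mem (check w') (check v) = (if w' \<in> dom (fn v) then \<top> else (\<bottom> :: 'h proj))" for w'
    by (simp add: tv_mem_check eq SUP_top_bot Bex_def cong: SUP_cong_simp)
  ultimately have "tv_eq (check v) (check w) =
      (if (\<forall>v'\<in>dom (fn v). v' \<in> dom (fn w)) \<and> (\<forall>w'\<in>dom (fn w). w' \<in> dom (fn v)) then \<top> else (\<bottom> :: 'h proj))"
    by (simp add: tv_eq_check_check INF_top_bot cong: INF_cong_simp)
  then show ?case
    unfolding same by simp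
qed

section \<open>Equality and membership for real numbers\<close>

context
  fixes q :: "rat \<Rightarrow> 'k pset" and \<Q> :: "'h::complex_hilbert_space proj set"
  assumes q: "inj q"
begin

text \<open>In the join over all rationals \<open>s\<close>, the equality of
  \<open>check (q r)\<close> and \<open>check (q s)\<close> has value \<open>\<bot>\<close> unless
  \<open>r = s\<close>, because \<open>q\<close> is injective. Only the term at \<open>r\<close>
  survives.\<close>

lemma tv_mem_real:
  assumes "u \<in> reals \<Q> q"
  shows "tv_mem (check (q r)) u = val u (check (q r))"
proof -
  have dom: "dom (fn u) = range (\<lambda>r. check (q r))"
    using assms by (auto simp: reals_def)
  have "tv_mem (check (q r)) u = (\<Squnion>s. val u (check (q s)) \<sqinter> tv_eq (check (q r)) (check (q s)))"
    unfolding tv_mem.simps[of "check (q r)" u] dom image_image ..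
  also have "\<dots> = (\<Squnion>s. if r = s then val u (check (q r)) else \<bottom>)"
    by (intro SUP_cong refl) (simp add: tv_eq_check inj_eq[OF q])
  also have "\<dots> = val u (check (q r))"
  proof (rule antisym)
    show "(\<Squnion>s. if r = s then val u (check (q r)) else \<bottom>) \<le> val u (check (q r))"
      by (rule SUP_least) simp
    show "val u (check (q r)) \<le> (\<Squnion>s. if r = s then val u (check (q r)) else \<bottom>)"
      by (rule SUP_upper2[of r]) simp_all
  qed
  finally show ?thesis .
qed

text \<open>With memberships replaced by values through \<open>tv_mem_real\<close>, the recursive
  clause for equality is the meet over \<open>r\<close> of the biconditionals between the values of
  \<open>u\<close> and \<open>v\<close>. \<open>mem_range_iff\<close> reads each of them as
  agreement at \<open>x\<close>.\<close>

lemma tv_eq_real: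
  assumes "u \<in> reals \<Q> q" "v \<in> reals \<Q> q"
  shows "x \<in> range_proj (tv_eq u v) \<longleftrightarrow>
    (\<forall>r. app_proj (val u (check (q r))) x = app_proj (val v (check (q r))) x)"
proof -
  have dom: "dom (fn u) = range (\<lambda>r. check (q r))" "dom (fn v) = range (\<lambda>r. check (q r))"
    using assms by (auto simp: reals_def)
  show ?thesis
    unfolding mem_range_iff[symmetric]
    by (auto simp: tv_eq.simps[of u v] iff_def range_inf range_Inf dom image_image tv_mem_real assms)
qed

lemma tv_eq_real_trans:
  assumes "u \<in> reals \<Q> q" "v \<in> reals \<Q> q" "w \<in> reals \<Q> q"
  shows "tv_eq u v \<sqinter> tv_eq v w \<le> tv_eq u w"
  by (auto simp: less_eq_proj_def range_inf tv_eq_real assms)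

text \<open>A vector fixed by the value of \<open>u\<close> at \<open>r\<close>, on which the value
  of \<open>v\<close> at \<open>r\<close> acts in the same way, is fixed by the latter too.\<close>

lemma tv_mem_real_cong:
  assumes "u \<in> reals \<Q> q" "v \<in> reals \<Q> q"
  shows "tv_mem (check (q r)) u \<sqinter> tv_eq u v \<le> tv_mem (check (q r)) v"
  by (auto simp: less_eq_proj_def range_inf tv_eq_real tv_mem_real mem_range_proj[of _ "val _ _"] assms)

lemma tv_eq_real_refl:
  assumes "u \<in> reals \<Q> q"
  shows "tv_eq u u = \<top>"
  by (rule range_proj_inject) (auto simp: tv_eq_real[OF assms assms] mem_range_proj[of _ \<top>])

end

section \<open>Validity of bounded quantifiers and the equality axioms\<close>

lemma tv_BAll_eq_top_iff:
  "tv q (BAll u \<phi>) = \<top> \<longleftrightarrow> (\<forall>x\<in>dom (fn u). val u x \<le> tv q (\<phi> x))"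
  by (auto simp: imp_eq_top_iff INF_top_conv)

theorem theorem5p7:
  fixes \<Q> :: "'h::complex_hilbert_space proj set"
    and q :: "rat \<Rightarrow> ('i, 'h) idx pset"
    and R :: "(('i, 'h) idx, 'h proj) hfun"
  assumes "is_logic \<Q>" and "inj q" and "R = Reals_name \<Q> q"
  shows "tv q (\<^bold>\<forall>u\<^bold>\<in>R. u \<^bold>= u) = \<top> \<and>
    tv q (\<^bold>\<forall>u\<^bold>\<in>R. \<^bold>\<forall>v\<^bold>\<in>R. u \<^bold>= v \<^bold>\<longrightarrow> v \<^bold>= u) = \<top> \<and>
    tv q (\<^bold>\<forall>u\<^bold>\<in>R. \<^bold>\<forall>v\<^bold>\<in>R. \<^bold>\<forall>w\<^bold>\<in>R. u \<^bold>= v \<^bold>\<and> v \<^bold>= w \<^bold>\<longrightarrow> u \<^bold>= w) = \<top> \<and>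
    tv q (\<^bold>\<forall>v\<^bold>\<in>R. \<^bold>\<forall>x\<^bold>\<in>v. \<^bold>\<forall>y\<^bold>\<in>v. x \<^bold>= y \<^bold>\<and> x \<^bold>\<in> v \<^bold>\<longrightarrow> y \<^bold>\<in> v) = \<top> \<and>
    tv q (\<^bold>\<forall>u\<^bold>\<in>R. \<^bold>\<forall>v\<^bold>\<in>R. \<^bold>\<forall>x\<^bold>\<in>u. x \<^bold>\<in> u \<^bold>\<and> u \<^bold>= v \<^bold>\<longrightarrow> x \<^bold>\<in> v) = \<top>"
proof -
  have fnR: "fn R = (\<lambda>u. if u \<in> reals \<Q> q then Some \<top> else None)"
    unfolding assms(3) by (rule fn_Reals_name)
  have domR: "dom (fn R) = reals \<Q> q"
    unfolding fnR by (rule dom_const_on)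
  \<comment> \<open>Since \<open>R\<close> takes the value \<open>\<top>\<close> on its whole
    domain, the body has to be fully valid at every real.\<close>
  have BAll_R: "tv q (BAll R \<phi>) = \<top>" if "\<And>u. u \<in> reals \<Q> q \<Longrightarrow> tv q (\<phi> u) = \<top>" for \<phi>
    unfolding tv_BAll_eq_top_iff domR using that by simp
  \<comment> \<open>A body valid at every rational name lies above whatever value \<open>u\<close>
    assigns to that name.\<close>
  have BAll_real: "tv q (BAll u \<phi>) = \<top>"
    if "u \<in> reals \<Q> q" "\<And>r. tv q (\<phi> (check (q r))) = \<top>" for u \<phi>
    unfolding tv_BAll_eq_top_iff using that by (auto simp: reals_def)
  \<comment> \<open>The equality is \<open>\<top>\<close> if \<open>r = s\<close> and
    \<open>\<bot>\<close> otherwise, so the inequality is trivial in both cases, for any name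
    \<open>u\<close>.\<close>
  have substitution: "tv_eq (check (q r)) (check (q s)) \<sqinter> tv_mem (check (q r)) u \<le> tv_mem (check (q s)) u"
    for r s and u :: "(('i, 'h) idx, 'h proj) hfun"
    using inj_eq[OF assms(2)] by (simp add: tv_eq_check)
  show ?thesis
  proof (intro conjI)
    show "tv q (\<^bold>\<forall>u\<^bold>\<in>R. u \<^bold>= u) = \<top>"
      by (intro BAll_R) (simp add: tv_eq_real_refl[OF assms(2)])
    show "tv q (\<^bold>\<forall>u\<^bold>\<in>R. \<^bold>\<forall>v\<^bold>\<in>R. u \<^bold>= v \<^bold>\<longrightarrow> v \<^bold>= u) = \<top>"
      by (intro BAll_R) (simp add: imp_eq_top_iff tv_eq_commute)
    show "tv q (\<^bold>\<forall>u\<^bold>\<in>R. \<^bold>\<forall>v\<^bold>\<in>R. \<^bold>\<forall>w\<^bold>\<in>R. u \<^bold>= v \<^bold>\<and> v \<^bold>= w \<^bold>\<longrightarrow> u \<^bold>= w) = \<top>"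
      by (intro BAll_R) (simp add: imp_eq_top_iff tv_eq_real_trans[OF assms(2)])
    show "tv q (\<^bold>\<forall>v\<^bold>\<in>R. \<^bold>\<forall>x\<^bold>\<in>v. \<^bold>\<forall>y\<^bold>\<in>v. x \<^bold>= y \<^bold>\<and> x \<^bold>\<in> v \<^bold>\<longrightarrow> y \<^bold>\<in> v) = \<top>"
      by (intro BAll_R BAll_real) (simp_all add: imp_eq_top_iff substitution)
    show "tv q (\<^bold>\<forall>u\<^bold>\<in>R. \<^bold>\<forall>v\<^bold>\<in>R. \<^bold>\<forall>x\<^bold>\<in>u. x \<^bold>\<in> u \<^bold>\<and> u \<^bold>= v \<^bold>\<longrightarrow> x \<^bold>\<in> v) = \<top>"
      by (intro BAll_R BAll_real) (simp_all add: imp_eq_top_iff tv_mem_real_cong[OF assms(2)])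
  qed
qed

end
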